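(* If $\mathcal{B}$ is an RKBS on a set $X$ and $\Delta:=\mathrm{span}\{\delta_x:x\in X\}\subseteq\mathcal{B}^*$, then the weak$^*$ closure of $\Delta$ in $\mathcal{B}^*$ equals $\mathcal{B}^*$.
   Context: A Banach space $\mathcal{B}$ is a Banach space of functions on $X$ if its elements are (real-valued) functions on $X$ and, for each $f\in\mathcal{B}$, $\|f\|_{\mathcal{B}}=0$ implies $f(x)=0$ for all $x\in X$. It is an RKBS (reproducing kernel Banach space) on $X$ if each point evaluation functional $\delta_x:f\mapsto f(x)$, $x\in X$, is continuous on $\mathcal{B}$, i.e. there is $C_x>0$ with $|f(x)|\le C_x\|f\|_{\mathcal{B}}$ for all $f\in\mathcal{B}$. *)

theory Defs
  imports "HOL-Analysis.Analysis" "HOL-Library.Function_Algebras"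
begin

instantiation "fun" :: (type, real_vector) real_vector
begin

definition scaleR_fun :: "real \<Rightarrow> ('a \<Rightarrow> 'b) \<Rightarrow> 'a \<Rightarrow> 'b"
  where "scaleR_fun c f = (\<lambda>x. c *\<^sub>R f x)"

instance
  by standard (simp_all add: scaleR_fun_def fun_eq_iff scaleR_add_right scaleR_add_left)

end

lemma scaleR_fun_apply [simp]: "(c *\<^sub>R f) x = c *\<^sub>R f x"
  by (simp add: scaleR_fun_def)

text \<open>
  A real function on the set \<open>X\<close> is represented by a function on the ambient type that vanishes
  outside \<open>X\<close>, so that equality and the pointwise operations of the function type are those of
  functions on \<open>X\<close>. Likewise a functional on \<open>B\<close> is represented by its extension by \<open>0\<close>
  outside \<open>B\<close>.
\<close>

locale normed_function_space =
  fixes X :: "'a set" and B :: "('a \<Rightarrow> real) set" and N :: "('a \<Rightarrow> real) \<Rightarrow> real"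
  assumes subspace_B: "subspace B"
    and vanishes_outside: "\<And>f x. f \<in> B \<Longrightarrow> x \<notin> X \<Longrightarrow> f x = 0"
    and N_nonneg: "\<And>f. f \<in> B \<Longrightarrow> 0 \<le> N f"
    and N_scale: "\<And>c f. f \<in> B \<Longrightarrow> N (c *\<^sub>R f) = \<bar>c\<bar> * N f"
    and N_triangle: "\<And>f g. f \<in> B \<Longrightarrow> g \<in> B \<Longrightarrow> N (f + g) \<le> N f + N g"
    and N_zero: "\<And>f x. f \<in> B \<Longrightarrow> N f = 0 \<Longrightarrow> x \<in> X \<Longrightarrow> f x = 0"

text \<open>
  The norm is only meaningful on \<open>B\<close>, whereas \<^locale>\<open>Metric_space\<close> requires nonnegativity
  and symmetry on the whole type; hence the default value \<open>0\<close>.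
\<close>

definition norm_dist ::
    "('a \<Rightarrow> real) set \<Rightarrow> (('a \<Rightarrow> real) \<Rightarrow> real) \<Rightarrow> ('a \<Rightarrow> real) \<Rightarrow> ('a \<Rightarrow> real) \<Rightarrow> real"
  where "norm_dist B N f g = (if f \<in> B \<and> g \<in> B then N (f - g) else 0)"

lemma (in normed_function_space) Metric_space_norm_dist: "Metric_space B (norm_dist B N)"
proof
  have diff: "f - g \<in> B" if "f \<in> B" "g \<in> B" for f g
    using that subspace_B by (simp add: subspace_diff)
  show "0 \<le> norm_dist B N f g" for f g
    by (simp add: norm_dist_def N_nonneg diff)
  show "norm_dist B N f g = norm_dist B N g f" for f g
    using N_scale[of "f - g" "-1"] by (auto simp: norm_dist_def diff)
  show "norm_dist B N f g = 0 \<longleftrightarrow> f = g" if fg: "f \<in> B" "g \<in> B" for f g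
  proof
    assume "norm_dist B N f g = 0"
    hence N0: "N (f - g) = 0" using fg by (simp add: norm_dist_def)
    have "f x = g x" for x
      using N_zero[OF diff[OF fg] N0, of x] vanishes_outside[OF fg(1), of x]
        vanishes_outside[OF fg(2), of x]
      by (cases "x \<in> X") simp_all
    thus "f = g" by (simp add: fun_eq_iff)
  next
    assume "f = g"
    thus "norm_dist B N f g = 0"
      using N_scale[of 0 0] subspace_0[OF subspace_B] by (simp add: norm_dist_def)
  qed
  show "norm_dist B N f h \<le> norm_dist B N f g + norm_dist B N g h"
    if "f \<in> B" "g \<in> B" "h \<in> B" for f g h
    using N_triangle[OF diff[OF that(1,2)] diff[OF that(2,3)]] that by (simp add: norm_dist_def)
qed

locale banach_function_space = normed_function_space +
  assumes complete: "Metric_space.mcomplete B (norm_dist B N)"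

locale rkbs = banach_function_space +
  assumes eval_bounded: "\<And>x. x \<in> X \<Longrightarrow> \<exists>C>0. \<forall>f\<in>B. \<bar>f x\<bar> \<le> C * N f"

definition dual_space ::
    "('a \<Rightarrow> real) set \<Rightarrow> (('a \<Rightarrow> real) \<Rightarrow> real) \<Rightarrow> (('a \<Rightarrow> real) \<Rightarrow> real) set"
  where "dual_space B N = {\<phi>.
    (\<forall>f\<in>B. \<forall>g\<in>B. \<phi> (f + g) = \<phi> f + \<phi> g) \<and>
    (\<forall>c. \<forall>f\<in>B. \<phi> (c *\<^sub>R f) = c * \<phi> f) \<and>
    (\<exists>C. \<forall>f\<in>B. \<bar>\<phi> f\<bar> \<le> C * N f) \<and>
    (\<forall>f. f \<notin> B \<longrightarrow> \<phi> f = 0)}"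

text \<open>The coarsest topology on the dual making \<open>\<phi> \<mapsto> \<phi> f\<close> continuous for every \<open>f \<in> B\<close>.\<close>

definition weak_star_topology ::
    "('a \<Rightarrow> real) set \<Rightarrow> (('a \<Rightarrow> real) \<Rightarrow> real) \<Rightarrow> (('a \<Rightarrow> real) \<Rightarrow> real) topology"
  where "weak_star_topology B N =
    topology_generated_by {{\<phi> \<in> dual_space B N. \<phi> f \<in> U} | f U. f \<in> B \<and> open U}"

definition point_eval :: "('a \<Rightarrow> real) set \<Rightarrow> 'a \<Rightarrow> ('a \<Rightarrow> real) \<Rightarrow> real"
  where "point_eval B x = (\<lambda>f. if f \<in> B then f x else 0)"

definition eval_span :: "'a set \<Rightarrow> ('a \<Rightarrow> real) set \<Rightarrow> (('a \<Rightarrow> real) \<Rightarrow> real) set"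
  where "eval_span X B = span (point_eval B ` X)"

lemma (in normed_function_space) topspace_weak_star_topology:
  "topspace (weak_star_topology B N) = dual_space B N"
proof -
  have "{\<phi> \<in> dual_space B N. \<phi> 0 \<in> UNIV} \<in>
      {{\<phi> \<in> dual_space B N. \<phi> f \<in> U} | f U. f \<in> B \<and> open U}"
    using subspace_0[OF subspace_B] by blast
  thus ?thesis
    unfolding weak_star_topology_def topology_generated_by_topspace by auto
qed

lemma (in normed_function_space) subspace_dual_space: "subspace (dual_space B N)"
proof (rule subspaceI)
  show "0 \<in> dual_space B N"
    by (auto simp: dual_space_def intro!: exI[of _ 0])
  show "\<phi> + \<psi> \<in> dual_space B N" if phi_psi: "\<phi> \<in> dual_space B N" "\<psi> \<in> dual_space B N" for \<phi> \<psi>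
  proof -
    obtain C D where C: "\<forall>f\<in>B. \<bar>\<phi> f\<bar> \<le> C * N f" and D: "\<forall>f\<in>B. \<bar>\<psi> f\<bar> \<le> D * N f"
      using phi_psi by (auto simp: dual_space_def)
    have "\<bar>\<phi> f + \<psi> f\<bar> \<le> (C + D) * N f" if "f \<in> B" for f
      using bspec[OF C that] bspec[OF D that] by (simp add: distrib_right)
    hence "\<exists>C. \<forall>f\<in>B. \<bar>\<phi> f + \<psi> f\<bar> \<le> C * N f" by blast
    thus ?thesis using phi_psi by (simp add: dual_space_def distrib_left)
  qed
  show "c *\<^sub>R \<phi> \<in> dual_space B N" if phi: "\<phi> \<in> dual_space B N" for c \<phi>
  proof -
    obtain C where C: "\<forall>f\<in>B. \<bar>\<phi> f\<bar> \<le> C * N f"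
      using phi by (auto simp: dual_space_def)
    have "\<bar>c * \<phi> f\<bar> \<le> (\<bar>c\<bar> * C) * N f" if "f \<in> B" for f
      using mult_left_mono[OF bspec[OF C that] abs_ge_zero[of c]]
      by (simp add: abs_mult mult.assoc)
    hence "\<exists>C. \<forall>f\<in>B. \<bar>c * \<phi> f\<bar> \<le> C * N f" by blast
    thus ?thesis using phi by (simp add: dual_space_def distrib_left)
  qed
qed

lemma (in rkbs) eval_span_subset_dual_space: "eval_span X B \<subseteq> dual_space B N"
  unfolding eval_span_def
proof (rule span_minimal[OF _ subspace_dual_space], safe)
  fix x assume "x \<in> X"
  then obtain C where "\<forall>f\<in>B. \<bar>f x\<bar> \<le> C * N f"
    using eval_bounded by blast
  thus "point_eval B x \<in> dual_space B N"
    using subspace_add[OF subspace_B] subspace_scale[OF subspace_B]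
    by (auto simp: dual_space_def point_eval_def)
qed

end

theory Submission
  imports Defs
begin

text \<open>
  A basic weak* neighbourhood of a functional \<open>\<phi>\<close> constrains only its values at finitely many
  elements of \<open>B\<close>, so it is enough to find, for each finite \<open>F \<subseteq> B\<close>, a combination of point
  evaluations that agrees with \<open>\<phi>\<close> on \<open>F\<close>; this is \<open>eval_span_agrees_on_finite\<close>. By linearity one
  may replace \<open>F\<close> by a maximal independent subset, and then the question is pure linear algebra:
  finitely many linearly independent functions on \<open>X\<close> can be given arbitrary values by a
  combination of point evaluations (\<open>eval_span_interpolates_independent\<close>). That holds because
  point evaluations separate functions.

  The continuity of the evaluations places their span inside the dual space.
\<close>

lemma sum_fun_apply: "(\<Sum>i\<in>I. f i) x = (\<Sum>i\<in>I. (f i x :: 'b::comm_monoid_add))"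
  by (induction I rule: infinite_finite_induct) simp_all

lemma subspace_eval_span: "subspace (eval_span X B)"
  by (simp add: eval_span_def)

text \<open>
  The induction step needs a combination \<open>\<eta>\<close> of evaluations that kills \<open>F\<close> but not the new
  function \<open>f\<close>. The induction hypothesis supplies a family \<open>e\<close> in the span of the evaluations
  that is dual to \<open>F\<close>. Subtracting from the evaluation at \<open>x\<close> its interpolant
  \<open>\<Sum>g\<in>F. g x *\<^sub>R e g\<close> gives a functional vanishing on \<open>F\<close>. If all of these
  functionals vanished at \<open>f\<close> too, this would read \<open>f = (\<Sum>g\<in>F. e g f *\<^sub>R g)\<close>, contradicting
  independence.
\<close>

lemma eval_span_interpolates_independent:
  fixes F B :: "('a \<Rightarrow> real) set"
  assumes "finite F" "independent F" "F \<subseteq> B"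
    and outside: "\<And>f x. f \<in> B \<Longrightarrow> x \<notin> X \<Longrightarrow> f x = 0"
  shows "\<exists>\<psi>\<in>eval_span X B. \<forall>f\<in>F. \<psi> f = t f"
  using assms(1-3)
proof (induction F arbitrary: t rule: finite_induct)
  case empty
  then show ?case using subspace_0[OF subspace_eval_span] by blast
next
  case (insert f F)
  note W = subspace_eval_span[of X B]
  have ind: "independent F" and f: "f \<notin> span F" and FB: "F \<subseteq> B" "f \<in> B"
    using insert.prems insert.hyps by (auto simp: independent_insert)
  note IH = insert.IH[OF ind FB(1)]
  have "\<forall>g. \<exists>e. e \<in> eval_span X B \<and> (\<forall>h\<in>F. e h = (if h = g then 1 else 0))"
    using IH[of "\<lambda>h. if h = g then 1 else 0" for g] by (simp add: Bex_def)
  then obtain e where eW: "\<And>g. e g \<in> eval_span X B"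
    and e: "\<And>g h. h \<in> F \<Longrightarrow> e g h = (if h = g then 1 else 0)"
    by metis
  have "\<exists>\<eta>\<in>eval_span X B. (\<forall>g\<in>F. \<eta> g = 0) \<and> \<eta> f \<noteq> 0"
  proof (rule ccontr)
    assume "\<not> ?thesis"
    hence no: "\<eta> f = 0" if "\<eta> \<in> eval_span X B" "\<forall>g\<in>F. \<eta> g = 0" for \<eta>
      using that by blast
    have "f x = (\<Sum>g\<in>F. e g f * g x)" for x
    proof (cases "x \<in> X")
      case True
      define \<eta> where "\<eta> = point_eval B x - (\<Sum>g\<in>F. g x *\<^sub>R e g)"
      have "point_eval B x \<in> eval_span X B"
        using True by (auto simp: eval_span_def intro: span_base)
      hence "\<eta> \<in> eval_span X B"
        unfolding \<eta>_def by (intro subspace_diff[OF W] subspace_sum[OF W] subspace_scale[OF W] eW)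
      moreover have "\<eta> h = 0" if "h \<in> F" for h
        using that FB insert.hyps(1)
        by (auto simp: \<eta>_def sum_fun_apply e point_eval_def if_distrib cong: if_cong)
      ultimately have "\<eta> f = 0" using no by blast
      thus ?thesis
        using FB by (simp add: \<eta>_def sum_fun_apply point_eval_def mult.commute)
    next
      case False
      have "g x = 0" if "g \<in> F" for g using outside False that FB by blast
      thus ?thesis using outside[OF FB(2) False] by (simp add: sum.neutral)
    qed
    hence "f = (\<Sum>g\<in>F. e g f *\<^sub>R g)"
      by (simp add: fun_eq_iff sum_fun_apply)
    also have "\<dots> \<in> span F" by (intro span_sum span_scale span_base)
    finally show False using f by simp
  qed
  then obtain \<eta> where \<eta>: "\<eta> \<in> eval_span X B" "\<And>g. g \<in> F \<Longrightarrow> \<eta> g = 0" "\<eta> f \<noteq> 0"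
    by blast
  obtain \<psi> where \<psi>: "\<psi> \<in> eval_span X B" "\<And>g. g \<in> F \<Longrightarrow> \<psi> g = t g"
    using IH[of t] by blast
  have "\<psi> + ((t f - \<psi> f) / \<eta> f) *\<^sub>R \<eta> \<in> eval_span X B"
    by (intro subspace_add[OF W] subspace_scale[OF W] \<psi> \<eta>)
  moreover have "(\<psi> + ((t f - \<psi> f) / \<eta> f) *\<^sub>R \<eta>) g = t g" if "g \<in> insert f F" for g
    using that \<eta> \<psi> by auto
  ultimately show ?case by blast
qed

lemma (in normed_function_space) subspace_agreement:
  assumes "\<phi> \<in> dual_space B N" "\<psi> \<in> dual_space B N"
  shows "subspace {f \<in> B. \<phi> f = \<psi> f}"
proof (rule subspaceI)
  have zero: "\<theta> 0 = 0" if "\<theta> \<in> dual_space B N" for \<theta>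
  proof -
    have "\<theta> (0 *\<^sub>R 0) = 0 * \<theta> 0"
      using that subspace_0[OF subspace_B] unfolding dual_space_def by blast
    thus ?thesis by simp
  qed
  show "0 \<in> {f \<in> B. \<phi> f = \<psi> f}"
    using zero[OF assms(1)] zero[OF assms(2)] subspace_0[OF subspace_B] by simp
qed (use assms subspace_add[OF subspace_B] subspace_scale[OF subspace_B]
      in \<open>auto simp: dual_space_def\<close>)

lemma (in rkbs) eval_span_agrees_on_finite:
  assumes \<phi>: "\<phi> \<in> dual_space B N" and F: "finite F" "F \<subseteq> B"
  shows "\<exists>\<psi>\<in>eval_span X B. \<forall>f\<in>F. \<psi> f = \<phi> f"
proof -
  obtain G where G: "G \<subseteq> F" "independent G" "F \<subseteq> span G"
    using maximal_independent_subset[of F] by blast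
  obtain \<psi> where \<psi>: "\<psi> \<in> eval_span X B" "\<forall>g\<in>G. \<psi> g = \<phi> g"
    using eval_span_interpolates_independent[where t = \<phi>, OF finite_subset[OF G(1) F(1)] G(2)
        subset_trans[OF G(1) F(2)], of X] vanishes_outside by auto
  have "\<psi> \<in> dual_space B N" using \<psi>(1) eval_span_subset_dual_space by blast
  hence "span G \<subseteq> {f \<in> B. \<psi> f = \<phi> f}"
    using \<psi>(2) G(1) F(2) \<phi> by (intro span_minimal subspace_agreement) auto
  thus ?thesis using \<psi>(1) G(3) by blast
qed

text \<open>
  The set found here need not be a neighbourhood of \<open>\<phi>\<close>, since it fixes values exactly instead of
  up to an error; this suffices because the functionals to be placed in \<open>T\<close> interpolate exactly.
\<close>

lemma weak_star_open_finite_agreement: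
  assumes "openin (weak_star_topology B N) T" "\<phi> \<in> T"
  shows "\<exists>F. finite F \<and> F \<subseteq> B \<and> {\<psi> \<in> dual_space B N. \<forall>f\<in>F. \<psi> f = \<phi> f} \<subseteq> T"
proof -
  have "generate_topology_on {{\<phi> \<in> dual_space B N. \<phi> f \<in> U} | f U. f \<in> B \<and> open U} T"
    using assms(1) by (simp add: weak_star_topology_def openin_topology_generated_by_iff)
  thus ?thesis using assms(2)
  proof (induction rule: generate_topology_on.induct)
    case Empty
    then show ?case by simp
  next
    case (Int S T)
    hence "\<phi> \<in> S" "\<phi> \<in> T" by auto
    from Int.IH(1)[OF this(1)] Int.IH(2)[OF this(2)] obtain F G where
      FG: "finite F" "F \<subseteq> B" "finite G" "G \<subseteq> B"
      and S: "{\<psi> \<in> dual_space B N. \<forall>f\<in>F. \<psi> f = \<phi> f} \<subseteq> S"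
      and T: "{\<psi> \<in> dual_space B N. \<forall>f\<in>G. \<psi> f = \<phi> f} \<subseteq> T"
      by (elim exE conjE)
    have "{\<psi> \<in> dual_space B N. \<forall>f\<in>F \<union> G. \<psi> f = \<phi> f} \<subseteq> S \<inter> T"
      using S T by (simp add: subset_iff)
    with FG show ?case by (intro exI[of _ "F \<union> G"]) simp
  next
    case (UN K)
    then obtain S where S: "S \<in> K" "\<phi> \<in> S" by blast
    from UN.IH[OF S] S(1) show ?case by (meson Union_upper subset_trans)
  next
    case (Basis S)
    then obtain f U where S: "S = {\<phi> \<in> dual_space B N. \<phi> f \<in> U}" and f: "f \<in> B" by blast
    have "\<phi> f \<in> U" using Basis.prems S by simp
    hence "{\<psi> \<in> dual_space B N. \<forall>h\<in>{f}. \<psi> h = \<phi> h} \<subseteq> S" by (simp add: S subset_iff)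
    with f show ?case by (intro exI[of _ "{f}"]) simp
  qed
qed

theorem proposition2:
  fixes X :: "'a set" and B :: "('a \<Rightarrow> real) set" and N :: "('a \<Rightarrow> real) \<Rightarrow> real"
  assumes "rkbs X B N"
  shows "weak_star_topology B N closure_of eval_span X B = dual_space B N"
proof -
  interpret rkbs X B N by (rule assms)
  have "\<phi> \<in> weak_star_topology B N closure_of eval_span X B" if \<phi>: "\<phi> \<in> dual_space B N" for \<phi>
    unfolding in_closure_of topspace_weak_star_topology
  proof (intro conjI allI impI)
    show "\<phi> \<in> dual_space B N" by (rule \<phi>)
    fix T assume "\<phi> \<in> T \<and> openin (weak_star_topology B N) T"
    hence "\<exists>F. finite F \<and> F \<subseteq> B \<and> {\<psi> \<in> dual_space B N. \<forall>f\<in>F. \<psi> f = \<phi> f} \<subseteq> T"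
      by (intro weak_star_open_finite_agreement) simp_all
    then obtain F where F: "finite F" "F \<subseteq> B"
      "{\<psi> \<in> dual_space B N. \<forall>f\<in>F. \<psi> f = \<phi> f} \<subseteq> T"
      by (elim exE conjE)
    obtain \<psi> where \<psi>: "\<psi> \<in> eval_span X B" "\<forall>f\<in>F. \<psi> f = \<phi> f"
      using eval_span_agrees_on_finite[OF \<phi> F(1,2)] by (elim bexE)
    have "\<psi> \<in> T"
      using F(3) \<psi> subsetD[OF eval_span_subset_dual_space \<psi>(1)] by (simp add: subset_iff)
    with \<psi>(1) show "\<exists>\<psi>. \<psi> \<in> eval_span X B \<and> \<psi> \<in> T" by (intro exI conjI)
  qed
  thus ?thesis
    using closure_of_subset_topspace[of "weak_star_topology B N" "eval_span X B"]
    by (auto simp: topspace_weak_star_topology)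
qed

end
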